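(* Let $C$ be a closed normal cone with nonempty interior $C^\circ$ in a real Banach space $X$ and let $f\colon C^\circ\to C^\circ$ be order-preserving and homogeneous. Then $$r_{C^\circ}(f)=\inf_{y\in C^\circ} M(f(y)/y).$$
   Context: A cone $C\subseteq X$ is a convex set with $C\cap(-C)=\{0\}$ and $\lambda C\subseteq C$ for all $\lambda\ge 0$; $x\le_C y$ means $y-x\in C$. $C$ is normal if there is $\kappa\ge 0$ with $\|x\|\le\kappa\|y\|$ whenever $0\le_C x\le_C y$. $f$ is order-preserving if $x\le_C y$ implies $f(x)\le_C f(y)$, and homogeneous if $f(\lambda x)=\lambda f(x)$ for all $\lambda>0$. For $x\in X$ and $y\in C^\circ$, $M(x/y)=\inf\{\beta\in\mathbb{R}\colon x\le_C\beta y\}$. The partial spectral radius is $r_{C^\circ}(f)=\lim_{k\to\infty}\|f^k\|_{C^\circ}^{1/k}$, where $\|f^k\|_{C^\circ}=\sup\{\|f^k(x)\|\colon x\in C^\circ,\ \|x\|\le1\}$ (these suprema are finite and the limit exists). *)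

theory Defs
  imports "HOL-Analysis.Analysis"
begin

text \<open>The library predicate \<^const>\<open>cone\<close> only expresses closure under scaling by
  nonnegative reals; a cone in the sense used here is moreover convex and pointed.\<close>

definition pointed_convex_cone :: "'a::real_vector set \<Rightarrow> bool" where
  "pointed_convex_cone C \<longleftrightarrow> convex C \<and> C \<inter> uminus ` C = {0} \<and> cone C"

definition cone_le :: "'a::real_vector set \<Rightarrow> 'a \<Rightarrow> 'a \<Rightarrow> bool" where
  "cone_le C x y \<longleftrightarrow> y - x \<in> C"

definition normal_cone :: "'a::real_normed_vector set \<Rightarrow> bool" where
  "normal_cone C \<longleftrightarrow>
     (\<exists>\<kappa>\<ge>0. \<forall>x y. cone_le C 0 x \<and> cone_le C x y \<longrightarrow> norm x \<le> \<kappa> * norm y)"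

definition order_preserving_on :: "'a::real_vector set \<Rightarrow> 'a set \<Rightarrow> ('a \<Rightarrow> 'a) \<Rightarrow> bool" where
  "order_preserving_on C D f \<longleftrightarrow>
     (\<forall>x\<in>D. \<forall>y\<in>D. cone_le C x y \<longrightarrow> cone_le C (f x) (f y))"

definition homogeneous_on :: "'a::real_vector set \<Rightarrow> ('a \<Rightarrow> 'a) \<Rightarrow> bool" where
  "homogeneous_on D f \<longleftrightarrow> (\<forall>x\<in>D. \<forall>t>0. f (t *\<^sub>R x) = t *\<^sub>R f x)"

text \<open>The quantity \<open>M(x/y)\<close>. When \<open>C\<close> is closed and \<open>y \<noteq> 0\<close> is an interior point
  of \<open>C\<close>, the set below is nonempty and bounded below, so the infimum is a genuine one.\<close>

definition cone_M :: "'a::real_vector set \<Rightarrow> 'a \<Rightarrow> 'a \<Rightarrow> real" where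
  "cone_M C x y = Inf {\<beta>. cone_le C x (\<beta> *\<^sub>R y)}"

definition norm_on :: "'a::real_normed_vector set \<Rightarrow> ('a \<Rightarrow> 'a) \<Rightarrow> real" where
  "norm_on D g = Sup {norm (g x) |x. x \<in> D \<and> norm x \<le> 1}"

text \<open>The term for \<open>k = 0\<close> is immaterial to the limit.\<close>

definition partial_spectral_radius :: "'a::real_normed_vector set \<Rightarrow> ('a \<Rightarrow> 'a) \<Rightarrow> real" where
  "partial_spectral_radius D f = lim (\<lambda>k. root k (norm_on D (f ^^ k)))"

end

theory Submission
  imports Defs
begin

text \<open>
  Write \<open>x \<preceq> y\<close> for the order of the cone, \<open>D\<close> for its interior, fix \<open>e \<in> D\<close>, and let
  \<open>m\<close> be the infimum on the right-hand side. It suffices to bound \<open>norm_on D (f ^^ k)\<close> above by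
  a multiple of \<open>\<beta> ^ k\<close> for every \<open>\<beta> > m\<close> and below by a multiple of \<open>\<lambda> ^ k\<close> for every
  \<open>0 < \<lambda> < m\<close>; taking \<open>k\<close>-th roots then squeezes the limit to \<open>m\<close>.

  The upper bound (\<open>norm_iterate_upper\<close>) is immediate: if \<open>f y \<preceq> \<beta> y\<close>, then
  \<open>f ^^ k\<close> maps the multiple \<open>c y\<close>, which dominates the unit ball, below \<open>c \<beta> ^ k y\<close>, and
  normality turns this into a bound on norms.

  For the lower bound choose \<open>\<delta> > 0\<close> with \<open>(1 + \<delta>) \<lambda> < m\<close>, and iterate
  \<open>y\<^sub>0 = e\<close>, \<open>y\<^sub>k\<^sub>+\<^sub>1 = f y\<^sub>k / \<lambda> + e\<close>. If all \<open>y\<^sub>k\<close> were below one \<open>R e\<close>, then adding \<open>e\<close> would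
  shrink the bound on \<open>M(y\<^sub>k\<^sub>+\<^sub>1/y\<^sub>k) - 1\<close> by the factor \<open>1 - 1/R\<close> at each step, so that eventually
  \<open>f y\<^sub>k \<preceq> \<lambda> y\<^sub>k\<^sub>+\<^sub>1 \<preceq> (1 + \<delta>) \<lambda> y\<^sub>k\<close>, contradicting the choice of \<open>\<delta>\<close>
  (\<open>perturbed_orbit_bounded\<close>). Hence the orbit is unbounded relative to \<open>e\<close>, and the
  rescaled point \<open>z = y\<^sub>k / R\<close> with \<open>R\<close> close to \<open>M(y\<^sub>k/e)\<close>, for suitable \<open>k\<close>, satisfies \<open>z \<preceq> e\<close>,
  \<open>M(z/e)\<close> close to 1, and \<open>f z \<succeq> \<lambda> (z - e/R)\<close> with \<open>R\<close> as large as desired. Because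
  \<open>f ((f ^^ n) e)\<close> is an interior point, the error \<open>e/R\<close> can be absorbed at each of a
  fixed number of steps, which gives \<open>(1 + \<sigma>) (f ^^ n) e \<succeq> \<lambda> ^ n z\<close> with \<open>\<sigma>\<close> as small
  as desired (\<open>iterate_dominates\<close>). Therefore \<open>M((f ^^ n) e/e) \<ge> \<lambda> ^ n\<close>, and the norm of
  \<open>(f ^^ n) e\<close> is at least a fixed multiple of this.
\<close>

section \<open>Squeezing the limit of k-th roots\<close>

lemma tendsto_root_of_geometric_bounds:
  fixes a :: "nat \<Rightarrow> real"
  assumes nonneg: "\<And>k. 0 \<le> a k"
    and upper: "\<And>\<beta>. m < \<beta> \<Longrightarrow> \<exists>K>0. \<forall>k. a k \<le> K * \<beta> ^ k"
    and lower: "\<And>l. 0 < l \<Longrightarrow> l < m \<Longrightarrow> \<exists>c>0. \<forall>k. c * l ^ k \<le> a k"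
    and m: "0 \<le> m"
  shows "(\<lambda>k. root k (a k)) \<longlonglongrightarrow> m"
proof -
  have root_geo: "root k (c * b ^ k) = root k c * b" if "k > 0" "b \<ge> 0" for k c and b :: real
    using that by (simp add: real_root_mult real_root_power_cancel)
  have lim_geo: "(\<lambda>k. root k c * b) \<longlonglongrightarrow> b" if "c > 0" for c b :: real
    using tendsto_mult[OF LIMSEQ_root_const[OF that] tendsto_const[of b]] by simp
  show ?thesis
  proof (rule order_tendstoI)
    fix u assume "u < m"
    show "\<forall>\<^sub>F k in sequentially. u < root k (a k)"
    proof (cases "u < 0")
      case True
      have "u < root k (a k)" for k
        using True nonneg[of k] real_root_ge_zero[of "a k" k] by linarith
      then show ?thesis by simp
    next
      case False
      obtain l where l: "u < l" "l < m" using \<open>u < m\<close> dense by blast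
      then obtain c where c: "c > 0" "\<And>k. c * l ^ k \<le> a k" using lower[of l] False by auto
      have "\<forall>\<^sub>F k in sequentially. u < root k c * l"
        using order_tendstoD(1)[OF lim_geo[OF c(1)] l(1)] .
      then show ?thesis using eventually_gt_at_top[of 0]
      proof eventually_elim
        case (elim k)
        have "root k (c * l ^ k) \<le> root k (a k)" using c(2)[of k] elim(2) by simp
        then show ?case using elim root_geo[of k l c] False l by simp
      qed
    qed
  next
    fix u assume "m < u"
    obtain b where b: "m < b" "b < u" using \<open>m < u\<close> dense by blast
    then obtain K where K: "K > 0" "\<And>k. a k \<le> K * b ^ k" using upper[of b] by auto
    have "\<forall>\<^sub>F k in sequentially. root k K * b < u"
      using order_tendstoD(2)[OF lim_geo[OF K(1)] b(2)] .
    then show "\<forall>\<^sub>F k in sequentially. root k (a k) < u" using eventually_gt_at_top[of 0]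
    proof eventually_elim
      case (elim k)
      have "root k (a k) \<le> root k (K * b ^ k)" using K(2)[of k] elim(2) by simp
      then show ?case using elim root_geo[of k b K] m b by simp
    qed
  qed
qed

section \<open>The order of a cone and its interior points\<close>

text \<open>A pointed convex cone in a nonzero normed space. Its interior may be empty; lemmas that
  need an interior point take it as a parameter.\<close>

locale cone_order =
  fixes C :: "'a::real_normed_vector set"
  assumes cone: "pointed_convex_cone C"
    and nontrivial: "(UNIV :: 'a set) \<noteq> {0}"
begin

abbreviation le (infix "\<preceq>" 50) where "x \<preceq> y \<equiv> cone_le C x y"
abbreviation D where "D \<equiv> interior C"

lemma scale_mem: "x \<in> C \<Longrightarrow> 0 \<le> t \<Longrightarrow> t *\<^sub>R x \<in> C"
  using cone by (auto simp: pointed_convex_cone_def cone_def)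

lemma add_mem:
  assumes "x \<in> C" "y \<in> C"
  shows "x + y \<in> C"
proof -
  have "(1/2) *\<^sub>R x + (1/2) *\<^sub>R y \<in> C"
    using cone assms by (intro convexD) (auto simp: pointed_convex_cone_def)
  from scale_mem[OF this, of 2] show ?thesis by (simp add: scaleR_add_right)
qed

lemma interior_mem: "x \<in> D \<Longrightarrow> x \<in> C"
  using interior_subset by blast

lemma pointed: "x \<in> C \<Longrightarrow> - x \<in> C \<Longrightarrow> x = 0"
  using cone by (force simp: pointed_convex_cone_def)

lemma le_trans: "x \<preceq> y \<Longrightarrow> y \<preceq> z \<Longrightarrow> x \<preceq> z"
  using add_mem[of "y - x" "z - y"] by (simp add: cone_le_def)

lemma le_scale: "x \<preceq> y \<Longrightarrow> 0 \<le> t \<Longrightarrow> t *\<^sub>R x \<preceq> t *\<^sub>R y"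
  using scale_mem[of "y - x" t] by (simp add: cone_le_def scaleR_diff_right)

lemma le_add: "x \<preceq> y \<Longrightarrow> u \<preceq> v \<Longrightarrow> x + u \<preceq> y + v"
  using add_mem[of "y - x" "v - u"] by (simp add: cone_le_def algebra_simps)

lemma le_scale_left: "y \<in> C \<Longrightarrow> s \<le> t \<Longrightarrow> s *\<^sub>R y \<preceq> t *\<^sub>R y"
  using scale_mem[of y "t - s"] by (simp add: cone_le_def algebra_simps)

lemma interior_add_mem:
  assumes "x \<in> D" "y \<in> C"
  shows "x + y \<in> D"
proof -
  have "(\<lambda>u. y + u) ` D \<subseteq> C"
    using add_mem[OF assms(2)] interior_mem by auto
  then have "(\<lambda>u. y + u) ` D \<subseteq> D"
    by (intro interior_maximal open_translation open_interior)
  then show ?thesis using assms(1) by (auto simp: add.commute)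
qed

lemma interior_scale_mem:
  assumes "x \<in> D" "0 < t"
  shows "t *\<^sub>R x \<in> D"
proof -
  have "(\<lambda>u. t *\<^sub>R u) ` D \<subseteq> C"
    using scale_mem interior_mem assms(2) by auto
  then have "(\<lambda>u. t *\<^sub>R u) ` D \<subseteq> D"
    using assms(2) by (intro interior_maximal open_scaling open_interior) auto
  then show ?thesis using assms(1) by auto
qed

text \<open>An interior point is an order unit, uniformly on balls.\<close>

lemma order_unit:
  assumes "e \<in> D"
  shows "\<exists>r>0. \<forall>x. x \<preceq> (norm x / r) *\<^sub>R e"
proof -
  obtain r where r: "r > 0" "cball e r \<subseteq> C"
    using assms mem_interior_cball by blast
  have "x \<preceq> (norm x / r) *\<^sub>R e" for x
  proof (cases "x = 0")
    case True
    then show ?thesis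
      using scale_mem[OF interior_mem[OF assms], of 0] by (simp add: cone_le_def)
  next
    case False
    have "e - (r / norm x) *\<^sub>R x \<in> C"
      using r False by (intro subsetD[OF r(2)]) (simp add: dist_norm)
    from scale_mem[OF this, of "norm x / r"] show ?thesis
      using r(1) False by (simp add: cone_le_def scaleR_diff_right)
  qed
  with r(1) show ?thesis by blast
qed

lemma dominated_by_unit:
  assumes "e \<in> D"
  obtains t where "t > 0" "x \<preceq> t *\<^sub>R e"
proof -
  obtain r where r: "r > 0" "\<And>x. x \<preceq> (norm x / r) *\<^sub>R e"
    using order_unit[OF assms] by blast
  have "x \<preceq> (norm x / r + 1) *\<^sub>R e"
    by (rule le_trans[OF r(2) le_scale_left[OF interior_mem[OF assms]]]) simp
  moreover have "norm x / r + 1 > 0" using r(1) by (simp add: add_nonneg_pos)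
  ultimately show ?thesis using that by blast
qed

text \<open>This is where a nontrivial space is needed: otherwise 0 is interior to the cone.\<close>

lemma zero_notin_interior: "0 \<notin> D"
proof
  assume "0 \<in> D"
  from order_unit[OF this] obtain r where r: "\<And>x. x \<preceq> (norm x / r) *\<^sub>R (0::'a)" by blast
  have "x = 0" for x :: 'a
    using r[of x] r[of "- x"] by (intro pointed) (auto simp: cone_le_def)
  then show False using nontrivial by auto
qed

lemma coeff_nonneg:
  assumes "x \<in> C" "y \<in> D" "x \<preceq> t *\<^sub>R y"
  shows "0 \<le> t"
proof (rule ccontr)
  assume t: "\<not> 0 \<le> t"
  have "t *\<^sub>R y \<in> C"
    using add_mem[OF assms(1)] assms(3) by (force simp: cone_le_def)
  from scale_mem[OF this, of "- inverse t"] have "- y \<in> C" using t by simp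
  then have "y = 0" using pointed interior_mem assms(2) by blast
  then show False using assms(2) zero_notin_interior by blast
qed

lemma cone_M_set_bdd_below:
  assumes "x \<in> C" "y \<in> D"
  shows "bdd_below {t. x \<preceq> t *\<^sub>R y}"
  using coeff_nonneg[OF assms] by (intro bdd_belowI[of _ 0]) auto

lemma cone_M_set_nonempty:
  assumes "y \<in> D"
  shows "{t. x \<preceq> t *\<^sub>R y} \<noteq> {}"
  using dominated_by_unit[OF assms, of x] by blast

lemma cone_M_nonneg:
  assumes "x \<in> C" "y \<in> D"
  shows "0 \<le> cone_M C x y"
  unfolding cone_M_def
  using cone_M_set_nonempty[OF assms(2)] coeff_nonneg[OF assms]
  by (intro cInf_greatest) auto

lemma cone_M_le:
  assumes "x \<in> C" "y \<in> D" "x \<preceq> t *\<^sub>R y"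
  shows "cone_M C x y \<le> t"
  unfolding cone_M_def
  using cone_M_set_bdd_below[OF assms(1,2)] assms(3) by (intro cInf_lower) auto

lemma le_of_cone_M_less:
  assumes "y \<in> D" "cone_M C x y < t"
  shows "x \<preceq> t *\<^sub>R y"
proof -
  obtain s where s: "x \<preceq> s *\<^sub>R y" "s < t"
    using cInf_lessD[OF cone_M_set_nonempty[OF assms(1), of x]] assms(2)
    unfolding cone_M_def by auto
  then show ?thesis
    using le_trans le_scale_left[OF interior_mem[OF assms(1)], of s t] by simp
qed

end

section \<open>Order-preserving homogeneous maps\<close>

text \<open>An order-preserving homogeneous self-map of the interior of the cone; the values of \<open>f\<close>
  elsewhere are arbitrary.\<close>

locale cone_map = cone_order C for C :: "'a::real_normed_vector set" +
  fixes f :: "'a \<Rightarrow> 'a"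
  assumes maps: "f \<in> D \<rightarrow> D"
    and order_pres: "order_preserving_on C D f"
    and homogeneous: "homogeneous_on D f"
begin

lemma map_mem: "x \<in> D \<Longrightarrow> f x \<in> D"
  using maps by blast

lemma map_mono: "x \<in> D \<Longrightarrow> y \<in> D \<Longrightarrow> x \<preceq> y \<Longrightarrow> f x \<preceq> f y"
  using order_pres by (simp add: order_preserving_on_def)

lemma map_scale: "x \<in> D \<Longrightarrow> 0 < t \<Longrightarrow> f (t *\<^sub>R x) = t *\<^sub>R f x"
  using homogeneous by (simp add: homogeneous_on_def)

lemma iterate_mem: "x \<in> D \<Longrightarrow> (f ^^ n) x \<in> D"
  by (induction n) (auto intro: map_mem)

lemma iterate_mono: "x \<in> D \<Longrightarrow> y \<in> D \<Longrightarrow> x \<preceq> y \<Longrightarrow> (f ^^ n) x \<preceq> (f ^^ n) y"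
  by (induction n) (auto intro: map_mono iterate_mem)

lemma iterate_scale: "x \<in> D \<Longrightarrow> 0 < t \<Longrightarrow> (f ^^ n) (t *\<^sub>R x) = t *\<^sub>R (f ^^ n) x"
  by (induction n) (auto simp: map_scale iterate_mem)

subsection \<open>Upper bound for the iterates\<close>

lemma iterate_subeigen:
  assumes "y \<in> D" "f y \<preceq> b *\<^sub>R y" "0 < b"
  shows "(f ^^ n) y \<preceq> b ^ n *\<^sub>R y"
proof (induction n)
  case 0
  show ?case using le_scale_left[OF interior_mem[OF assms(1)], of 1 1] by simp
next
  case (Suc n)
  have "f ((f ^^ n) y) \<preceq> f (b ^ n *\<^sub>R y)"
    using Suc assms by (intro map_mono iterate_mem interior_scale_mem) auto
  also have "f (b ^ n *\<^sub>R y) = b ^ n *\<^sub>R f y" using assms by (simp add: map_scale)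
  finally show ?case
    using le_trans le_scale[OF assms(2), of "b ^ n"] assms(3)
    by (simp add: mult.commute)
qed

lemma norm_iterate_upper:
  assumes "normal_cone C" "y \<in> D" "f y \<preceq> b *\<^sub>R y" "0 < b"
  obtains K where "K > 0"
    "\<And>n x. x \<in> D \<Longrightarrow> norm x \<le> 1 \<Longrightarrow> norm ((f ^^ n) x) \<le> K * b ^ n"
proof -
  obtain \<kappa> where \<kappa>: "\<kappa> \<ge> 0" "\<And>x y. 0 \<preceq> x \<Longrightarrow> x \<preceq> y \<Longrightarrow> norm x \<le> \<kappa> * norm y"
    using assms(1) unfolding normal_cone_def by blast
  obtain r where r: "r > 0" "\<And>x. x \<preceq> (norm x / r) *\<^sub>R y"
    using order_unit[OF assms(2)] by blast
  define K where "K = \<kappa> * (norm y / r) + 1"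
  have "norm ((f ^^ n) x) \<le> K * b ^ n" if x: "x \<in> D" "norm x \<le> 1" for n x
  proof -
    have "x \<preceq> (1 / r) *\<^sub>R y"
      using x(2) r(1)
      by (intro le_trans[OF r(2) le_scale_left[OF interior_mem[OF assms(2)]]])
        (simp add: divide_right_mono)
    then have "(f ^^ n) x \<preceq> (f ^^ n) ((1 / r) *\<^sub>R y)"
      using x(1) assms(2) r(1) by (intro iterate_mono interior_scale_mem) auto
    also have "(f ^^ n) ((1 / r) *\<^sub>R y) = (1 / r) *\<^sub>R (f ^^ n) y"
      using assms(2) r(1) by (simp add: iterate_scale)
    finally have "(f ^^ n) x \<preceq> (1 / r) *\<^sub>R (b ^ n *\<^sub>R y)"
      using le_trans le_scale[OF iterate_subeigen[OF assms(2-4)], of "1 / r" n] r(1) by simp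
    moreover have "0 \<preceq> (f ^^ n) x"
      using interior_mem[OF iterate_mem[OF x(1)]] by (simp add: cone_le_def)
    ultimately have "norm ((f ^^ n) x) \<le> \<kappa> * norm ((1 / r) *\<^sub>R (b ^ n *\<^sub>R y))"
      by (intro \<kappa>(2))
    also have "\<dots> = \<kappa> * (norm y / r) * b ^ n" using r(1) assms(4) by simp
    also have "\<dots> \<le> K * b ^ n" using assms(4) by (intro mult_right_mono) (auto simp: K_def)
    finally show ?thesis .
  qed
  moreover have "K > 0" using \<kappa>(1) r(1) by (simp add: K_def add_nonneg_pos)
  ultimately show ?thesis using that by blast
qed

subsection \<open>Lower bound for the iterates\<close>

text \<open>The orbit of \<open>e\<close> under the perturbed map \<open>\<lambda>x. f x / l + e\<close>; for linear \<open>f\<close> these are the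
  partial sums of the Neumann series of \<open>e\<close>.\<close>

definition perturbed_orbit :: "real \<Rightarrow> 'a \<Rightarrow> nat \<Rightarrow> 'a" where
  "perturbed_orbit l e k = ((\<lambda>x. inverse l *\<^sub>R f x + e) ^^ k) e"

lemma perturbed_orbit_0: "perturbed_orbit l e 0 = e"
  by (simp add: perturbed_orbit_def)

lemma perturbed_orbit_Suc:
  "perturbed_orbit l e (Suc k) = inverse l *\<^sub>R f (perturbed_orbit l e k) + e"
  by (simp add: perturbed_orbit_def)

lemma perturbed_orbit_mem:
  assumes "e \<in> D" "0 < l"
  shows "perturbed_orbit l e k \<in> D"
proof (induction k)
  case 0
  then show ?case using assms by (simp add: perturbed_orbit_0)
next
  case (Suc k)
  then show ?case
    using assms by (simp add: perturbed_orbit_Suc interior_add_mem interior_scale_mem map_mem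
        interior_mem)
qed

lemma perturbed_orbit_increasing:
  assumes "e \<in> D" "0 < l"
  shows "perturbed_orbit l e k \<preceq> perturbed_orbit l e (Suc k)"
proof (induction k)
  case 0
  show ?case
    using assms scale_mem[OF interior_mem[OF map_mem[OF assms(1)]], of "inverse l"]
    by (simp add: perturbed_orbit_Suc perturbed_orbit_0 cone_le_def)
next
  case (Suc k)
  have "f (perturbed_orbit l e k) \<preceq> f (perturbed_orbit l e (Suc k))"
    by (intro map_mono perturbed_orbit_mem assms Suc)
  from le_scale[OF this, of "inverse l"] show ?case
    using assms(2) by (simp add: perturbed_orbit_Suc[of l e k] perturbed_orbit_Suc[of l e "Suc k"]
        cone_le_def)
qed

text \<open>Along an orbit bounded by \<open>R e\<close> the added term \<open>e\<close> is at least the fraction \<open>1 / R\<close> of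
  the current point; this makes the ratio of consecutive points contract to 1.\<close>

lemma perturbed_orbit_ratio:
  assumes "e \<in> D" "0 < l" "1 \<le> R"
    and bounded: "\<And>k. perturbed_orbit l e k \<preceq> R *\<^sub>R e"
  shows "perturbed_orbit l e (Suc k) \<preceq> (1 + R * (1 - 1 / R) ^ k) *\<^sub>R perturbed_orbit l e k"
proof (induction k)
  case 0
  show ?case
    using le_trans[OF bounded[of 1] le_scale_left[OF interior_mem[OF assms(1)], of R "1 + R"]]
    by (simp add: perturbed_orbit_0)
next
  case (Suc k)
  let ?y = "perturbed_orbit l e"
  define a where "a = R * (1 - 1 / R) ^ k"
  have a: "a \<ge> 0" using assms(3) by (simp add: a_def)
  note mem = perturbed_orbit_mem[OF assms(1,2)]
  have "f (?y (Suc k)) \<preceq> f ((1 + a) *\<^sub>R ?y k)"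
    using Suc a mem by (intro map_mono interior_scale_mem) (auto simp: a_def)
  also have "\<dots> = (1 + a) *\<^sub>R f (?y k)" using a mem by (simp add: map_scale)
  finally have 1: "inverse l *\<^sub>R f (?y (Suc k)) \<preceq> inverse l *\<^sub>R ((1 + a) *\<^sub>R f (?y k))"
    using assms(2) by (intro le_scale) auto
  have "inverse R *\<^sub>R ?y (Suc k) \<preceq> inverse R *\<^sub>R (R *\<^sub>R e)"
    using assms(3) by (intro le_scale bounded) auto
  then have "(a / R) *\<^sub>R ?y (Suc k) \<preceq> a *\<^sub>R e"
    using le_scale[of "inverse R *\<^sub>R ?y (Suc k)" e a] a assms(3) by (simp add: divide_inverse)
  then have "e \<preceq> (1 + a) *\<^sub>R e - (a / R) *\<^sub>R ?y (Suc k)"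
    by (simp add: cone_le_def algebra_simps)
  from le_add[OF 1 this]
  have "?y (Suc (Suc k)) \<preceq>
      inverse l *\<^sub>R ((1 + a) *\<^sub>R f (?y k)) + ((1 + a) *\<^sub>R e - (a / R) *\<^sub>R ?y (Suc k))"
    by (simp add: perturbed_orbit_Suc[of l e "Suc k"])
  also have "\<dots> = (1 + a) *\<^sub>R ?y (Suc k) - (a / R) *\<^sub>R ?y (Suc k)"
    by (simp add: perturbed_orbit_Suc[of l e k] scaleR_add_right mult.commute)
  also have "\<dots> = (1 + a - a / R) *\<^sub>R ?y (Suc k)" by (simp add: scaleR_diff_left)
  also have "1 + a - a / R = 1 + R * (1 - 1 / R) ^ Suc k" by (simp add: a_def algebra_simps)
  finally show ?case .
qed

lemma perturbed_orbit_bounded: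
  assumes "e \<in> D" "0 < l" "1 \<le> R" "0 < d"
    and bounded: "\<And>k. perturbed_orbit l e k \<preceq> R *\<^sub>R e"
  obtains y where "y \<in> D" "f y \<preceq> ((1 + d) * l) *\<^sub>R y"
proof -
  let ?y = "perturbed_orbit l e"
  note mem = perturbed_orbit_mem[OF assms(1,2)]
  have "(\<lambda>k. R * (1 - 1 / R) ^ k) \<longlonglongrightarrow> R * 0"
    using assms(3) by (intro tendsto_mult tendsto_const LIMSEQ_power_zero) auto
  then have "\<forall>\<^sub>F k in sequentially. R * (1 - 1 / R) ^ k < d"
    using assms(4) by (intro order_tendstoD(2)) auto
  then obtain k where k: "R * (1 - 1 / R) ^ k < d"
    by (auto simp: eventually_sequentially)
  have "f (?y k) \<preceq> l *\<^sub>R ?y (Suc k)"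
    using assms(2) scale_mem[OF interior_mem[OF assms(1)], of l]
    by (simp add: perturbed_orbit_Suc cone_le_def scaleR_add_right)
  also have "?y (Suc k) \<preceq> (1 + d) *\<^sub>R ?y k"
    using le_trans[OF perturbed_orbit_ratio[OF assms(1-3) bounded]]
      le_scale_left[OF interior_mem[OF mem[of k]]] k by simp
  from le_scale[OF this, of l] have "l *\<^sub>R ?y (Suc k) \<preceq> ((1 + d) * l) *\<^sub>R ?y k"
    using assms(2) by (simp add: mult.commute)
  finally (le_trans) show ?thesis using that mem by blast
qed

text \<open>The order of quantifiers matters: \<open>R\<close> may depend on \<open>n\<close> and \<open>s\<close>, but not on the
  approximate superharmonic point \<open>z\<close>.\<close>

lemma iterate_dominates:
  assumes "e \<in> D" "0 < l" "0 < s"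
  shows "\<exists>R0>0. \<forall>R\<ge>R0. \<forall>z\<in>D. z \<preceq> e \<longrightarrow> l *\<^sub>R (z - inverse R *\<^sub>R e) \<preceq> f z \<longrightarrow>
           l ^ n *\<^sub>R z \<preceq> (1 + s) *\<^sub>R (f ^^ n) e"
  using assms(3)
proof (induction n arbitrary: s)
  case 0
  have "e \<preceq> (1 + s) *\<^sub>R e"
    using le_scale_left[OF interior_mem[OF assms(1)], of 1 "1 + s"] 0 by simp
  then show ?case using le_trans by (intro exI[of _ 1]) auto
next
  case (Suc n)
  let ?w = "(f ^^ n) e"
  have w: "?w \<in> D" "f ?w \<in> D" using assms(1) iterate_mem map_mem by auto
  obtain R1 where R1: "R1 > 0"
    "\<And>R z. R \<ge> R1 \<Longrightarrow> z \<in> D \<Longrightarrow> z \<preceq> e \<Longrightarrow> l *\<^sub>R (z - inverse R *\<^sub>R e) \<preceq> f z \<Longrightarrow>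
           l ^ n *\<^sub>R z \<preceq> (1 + s / 2) *\<^sub>R ?w"
    using Suc.IH[of "s / 2"] Suc.prems by auto
  obtain t where t: "t > 0" "e \<preceq> t *\<^sub>R f ?w" using dominated_by_unit[OF w(2)] .
  \<comment> \<open>The error of one step is \<open>l ^ Suc n / R\<close> times \<open>e\<close>, hence at most \<open>s / 2\<close> times \<open>f ?w\<close>.\<close>
  define R0 where "R0 = max R1 (2 * l ^ Suc n * t / s)"
  have "l ^ Suc n *\<^sub>R z \<preceq> (1 + s) *\<^sub>R f ?w"
    if R: "R \<ge> R0" and z: "z \<in> D" "z \<preceq> e" "l *\<^sub>R (z - inverse R *\<^sub>R e) \<preceq> f z" for R z
  proof -
    have Rpos: "R > 0" using R R1(1) by (simp add: R0_def)
    have "l ^ n *\<^sub>R z \<preceq> (1 + s / 2) *\<^sub>R ?w" using R z by (intro R1(2)) (auto simp: R0_def)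
    then have "f (l ^ n *\<^sub>R z) \<preceq> f ((1 + s / 2) *\<^sub>R ?w)"
      using z(1) w(1) assms(2) Suc.prems by (intro map_mono interior_scale_mem) auto
    then have 1: "l ^ n *\<^sub>R f z \<preceq> (1 + s / 2) *\<^sub>R f ?w"
      using z(1) w(1) assms(2) Suc.prems by (simp add: map_scale)
    have 2: "l ^ n *\<^sub>R (l *\<^sub>R (z - inverse R *\<^sub>R e)) \<preceq> l ^ n *\<^sub>R f z"
      using z(3) assms(2) by (intro le_scale) auto
    have "l ^ Suc n * inverse R * t \<le> s / 2"
    proof -
      have "2 * l ^ Suc n * t / s \<le> R" using R by (simp add: R0_def)
      then show ?thesis using Rpos Suc.prems by (simp add: field_simps)
    qed
    then have "(l ^ Suc n * inverse R * t) *\<^sub>R f ?w \<preceq> (s / 2) *\<^sub>R f ?w"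
      by (intro le_scale_left interior_mem w)
    moreover have "(l ^ Suc n * inverse R) *\<^sub>R e \<preceq> (l ^ Suc n * inverse R) *\<^sub>R (t *\<^sub>R f ?w)"
      using t(2) assms(2) Rpos by (intro le_scale) auto
    ultimately have 3: "(l ^ Suc n * inverse R) *\<^sub>R e \<preceq> (s / 2) *\<^sub>R f ?w"
      using le_trans by (simp add: mult.assoc)
    have "l ^ n *\<^sub>R (l *\<^sub>R (z - inverse R *\<^sub>R e)) + (l ^ Suc n * inverse R) *\<^sub>R e
        = l ^ Suc n *\<^sub>R z"
      by (simp add: scaleR_diff_right mult_ac)
    moreover have "(1 + s / 2) *\<^sub>R f ?w + (s / 2) *\<^sub>R f ?w = (1 + s) *\<^sub>R f ?w"
      by (simp flip: scaleR_add_left)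
    ultimately show ?thesis using le_add[OF le_trans[OF 2 1] 3] by simp
  qed
  moreover have "R0 > 0" using R1(1) by (simp add: R0_def)
  ultimately show ?case by auto
qed

lemma iterate_unit_lower:
  assumes e: "e \<in> D" and l: "0 < l" and d: "0 < d"
    and no_subeigen: "\<And>y. y \<in> D \<Longrightarrow> \<not> f y \<preceq> ((1 + d) * l) *\<^sub>R y"
    and t: "(f ^^ n) e \<preceq> t *\<^sub>R e"
  shows "l ^ n \<le> t"
proof (rule ccontr)
  assume "\<not> l ^ n \<le> t"
  define q where "q = t / l ^ n"
  have "0 \<le> t" using coeff_nonneg[OF interior_mem[OF iterate_mem[OF e]] e t] .
  then have q: "0 \<le> q" "q < 1" using \<open>\<not> l ^ n \<le> t\<close> l by (auto simp: q_def)
  \<comment> \<open>Small enough that \<open>(1 + s) * q < 1\<close>.\<close>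
  define s where "s = (1 - q) / 2"
  have s: "s > 0" using q by (simp add: s_def)
  define p where "p = (1 + s) * q"
  have "1 - p = (1 - q) * (2 - q) / 2"
    by (simp add: p_def s_def field_simps)
  moreover have "(1 - q) * (2 - q) / 2 > 0" using q by simp
  ultimately have p: "p < 1" by linarith
  obtain R0 where R0: "R0 > 0"
    "\<And>R z. R \<ge> R0 \<Longrightarrow> z \<in> D \<Longrightarrow> z \<preceq> e \<Longrightarrow> l *\<^sub>R (z - inverse R *\<^sub>R e) \<preceq> f z \<Longrightarrow>
           l ^ n *\<^sub>R z \<preceq> (1 + s) *\<^sub>R (f ^^ n) e"
    using iterate_dominates[OF e l s, of n] by blast
  let ?y = "perturbed_orbit l e"
  note mem = perturbed_orbit_mem[OF e l]
  \<comment> \<open>Large enough for the domination above and for \<open>p * (M + 1) < M\<close> when \<open>M \<ge> B\<close>.\<close>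
  define B where "B = max R0 (max 1 (p / (1 - p) + 1))"
  have "1 \<le> B" by (simp add: B_def)
  from perturbed_orbit_bounded[OF e l this d] no_subeigen
  obtain k where k: "\<not> ?y k \<preceq> B *\<^sub>R e" by metis
  define M where "M = cone_M C (?y k) e"
  have MB: "B \<le> M" using le_of_cone_M_less[OF e, of "?y k" B] k by (force simp: M_def)
  define R where "R = M + 1"
  have R: "R \<ge> R0" "R > 0" using MB R0(1) by (auto simp: R_def B_def)
  have yR: "?y k \<preceq> R *\<^sub>R e" using le_of_cone_M_less[OF e, of "?y k" R] by (simp add: R_def M_def)
  define z where "z = inverse R *\<^sub>R ?y k"
  have zD: "z \<in> D" using mem R by (simp add: z_def interior_scale_mem)
  have ze: "z \<preceq> e" using le_scale[OF yR, of "inverse R"] R by (simp add: z_def)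
  have "f z = inverse R *\<^sub>R f (?y k)" using mem R by (simp add: z_def map_scale)
  also have "f (?y k) = l *\<^sub>R (?y (Suc k) - e)" using l by (simp add: perturbed_orbit_Suc)
  finally have fz: "f z = inverse R *\<^sub>R (l *\<^sub>R (?y (Suc k) - e))" .
  have "?y k - e \<preceq> ?y (Suc k) - e"
    using perturbed_orbit_increasing[OF e l, of k] by (simp add: cone_le_def)
  from le_scale[OF le_scale[OF this, of l], of "inverse R"]
  have "inverse R *\<^sub>R (l *\<^sub>R (?y k - e)) \<preceq> f z" using l R fz by simp
  moreover have "inverse R *\<^sub>R (l *\<^sub>R (?y k - e)) = l *\<^sub>R (z - inverse R *\<^sub>R e)"
    by (simp add: z_def scaleR_diff_right mult.commute)
  ultimately have "l ^ n *\<^sub>R z \<preceq> (1 + s) *\<^sub>R (f ^^ n) e"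
    by (intro R0(2)[OF R(1) zD ze]) simp
  also have "(1 + s) *\<^sub>R (f ^^ n) e \<preceq> (1 + s) *\<^sub>R (t *\<^sub>R e)"
    using s by (intro le_scale t) auto
  finally (le_trans) have "l ^ n *\<^sub>R z \<preceq> ((1 + s) * t) *\<^sub>R e" by simp
  from le_scale[OF this, of "R * inverse (l ^ n)"] have "?y k \<preceq> (R * p) *\<^sub>R e"
    using l R by (simp add: z_def p_def q_def divide_inverse mult_ac)
  then have "M \<le> R * p"
    unfolding M_def by (intro cone_M_le interior_mem mem e)
  then have "M * (1 - p) \<le> p" by (simp add: R_def algebra_simps)
  then have "M \<le> p / (1 - p)" using p by (simp add: pos_le_divide_eq)
  then show False using MB by (simp add: B_def)
qed

lemma norm_iterate_lower:
  assumes "e \<in> D" "0 < l" "0 < d"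
    and "\<And>y. y \<in> D \<Longrightarrow> \<not> f y \<preceq> ((1 + d) * l) *\<^sub>R y"
  obtains c where "c > 0" "\<And>n. c * l ^ n \<le> norm ((f ^^ n) e)"
proof -
  obtain r where r: "r > 0" "\<And>x. x \<preceq> (norm x / r) *\<^sub>R e"
    using order_unit[OF assms(1)] by blast
  have "r * l ^ n \<le> norm ((f ^^ n) e)" for n
    using iterate_unit_lower[OF assms r(2)] r(1) by (simp add: pos_le_divide_eq mult.commute)
  with r(1) show ?thesis using that by blast
qed

section \<open>The partial spectral radius\<close>

lemma partial_spectral_radius_eq:
  assumes normal: "normal_cone C" and nonempty: "D \<noteq> {}"
  shows "partial_spectral_radius D f = (INF y\<in>D. cone_M C (f y) y)"
proof -
  define m where "m = (INF y\<in>D. cone_M C (f y) y)"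
  have M_nonneg: "0 \<le> cone_M C (f y) y" if "y \<in> D" for y
    using that by (intro cone_M_nonneg interior_mem map_mem)
  then have bdd: "bdd_below ((\<lambda>y. cone_M C (f y) y) ` D)" by (intro bdd_belowI2[of _ 0])
  have m0: "0 \<le> m" unfolding m_def using nonempty M_nonneg by (intro cINF_greatest)
  have upper: "\<exists>K>0. \<forall>k. \<forall>x\<in>D. norm x \<le> 1 \<longrightarrow> norm ((f ^^ k) x) \<le> K * b ^ k"
    if "m < b" for b
  proof -
    obtain y where y: "y \<in> D" "cone_M C (f y) y < b"
      using \<open>m < b\<close> cINF_less_iff[OF nonempty bdd] unfolding m_def by blast
    show ?thesis
      using norm_iterate_upper[OF normal y(1) le_of_cone_M_less[OF y]] m0 \<open>m < b\<close>
      by (metis le_less_trans)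
  qed
  obtain e0 where e0: "e0 \<in> D" using nonempty by blast
  then have "e0 \<noteq> 0" using zero_notin_interior by blast
  define e where "e = inverse (norm e0) *\<^sub>R e0"
  have e: "e \<in> D" "norm e \<le> 1"
    using e0 \<open>e0 \<noteq> 0\<close> by (auto simp: e_def intro: interior_scale_mem)
  obtain K where K: "\<And>k x. x \<in> D \<Longrightarrow> norm x \<le> 1 \<Longrightarrow> norm ((f ^^ k) x) \<le> K * (m + 1) ^ k"
    using upper[of "m + 1"] by auto
  have norm_on_ge: "norm ((f ^^ k) e) \<le> norm_on D (f ^^ k)" for k
    unfolding norm_on_def using e K
    by (intro cSup_upper bdd_aboveI[of _ "K * (m + 1) ^ k"]) auto
  have "(\<lambda>k. root k (norm_on D (f ^^ k))) \<longlonglongrightarrow> m"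
  proof (rule tendsto_root_of_geometric_bounds[OF _ _ _ m0])
    show "0 \<le> norm_on D (f ^^ k)" for k
      using norm_on_ge[of k] norm_ge_zero order_trans by blast
  next
    fix b assume "m < b"
    then obtain K where K: "K > 0"
      "\<And>k x. x \<in> D \<Longrightarrow> norm x \<le> 1 \<Longrightarrow> norm ((f ^^ k) x) \<le> K * b ^ k"
      using upper by blast
    have "norm_on D (f ^^ k) \<le> K * b ^ k" for k
      unfolding norm_on_def using e K(2) by (intro cSup_least) auto
    with K(1) show "\<exists>K>0. \<forall>k. norm_on D (f ^^ k) \<le> K * b ^ k" by blast
  next
    fix l assume l: "0 < l" "l < m"
    then obtain u where u: "l < u" "u < m" using dense by blast
    define d where "d = u / l - 1"
    have d: "d > 0" "(1 + d) * l = u" using l u by (auto simp: d_def)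
    have "\<not> f y \<preceq> ((1 + d) * l) *\<^sub>R y" if y: "y \<in> D" for y
    proof
      assume "f y \<preceq> ((1 + d) * l) *\<^sub>R y"
      then have "cone_M C (f y) y \<le> u"
        using d(2) y by (intro cone_M_le interior_mem map_mem) auto
      moreover have "m \<le> cone_M C (f y) y" unfolding m_def using bdd y by (rule cINF_lower)
      ultimately show False using u by simp
    qed
    from norm_iterate_lower[OF e(1) l(1) d(1) this]
    obtain c where "c > 0" "\<And>n. c * l ^ n \<le> norm ((f ^^ n) e)" by blast
    then show "\<exists>c>0. \<forall>k. c * l ^ k \<le> norm_on D (f ^^ k)"
      using norm_on_ge order_trans by blast
  qed
  then show ?thesis unfolding partial_spectral_radius_def m_def by (rule limI)
qed

end

theorem theorem4p6:
  fixes C :: "'a::banach set" and f :: "'a \<Rightarrow> 'a"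
  assumes "(UNIV :: 'a set) \<noteq> {0}"
    and "pointed_convex_cone C"
    and "closed C"
    and "normal_cone C"
    and "interior C \<noteq> {}"
    and "f \<in> interior C \<rightarrow> interior C"
    and "order_preserving_on C (interior C) f"
    and "homogeneous_on (interior C) f"
  shows "partial_spectral_radius (interior C) f = (INF y\<in>interior C. cone_M C (f y) y)"
proof -
  interpret cone_map C f using assms by unfold_locales
  show ?thesis using assms by (intro partial_spectral_radius_eq)
qed

end
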